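(* Let $m \ge 1$, $n=2m$, and let $d_2=s_2(2^m-1)+1$ be a positive integer, where $s_2$ is an integer with $s_2 \not\equiv \frac12 \pmod{2^m+1}$ ($\frac12$ denoting the inverse of $2$ modulo $2^m+1$). Let $l=\gcd(2s_2-1,2^m+1)$. For $a\in\mathbb{F}_{2^m}$ and $b\in\mathbb{F}_{2^n}$ put $$S(a,b)=\sum_{x\in \mathbb{F}_{2^n}} (-1)^{\mathrm{Tr}_m(ax^{2^m+1})+\mathrm{Tr}_n(bx^{d_2})}.$$ Then, as $(a,b)$ ranges over $\mathbb{F}_{2^m}\times\mathbb{F}_{2^n}$, the value distribution of $S(a,b)$ is as follows: \begin{itemize} \item the value $2^{2m}$ occurs $1$ time; \item the value $(2l-1)2^{m}$ occurs $\frac{(2^{2m}-1)(2^m-l+1)}{2l^2}$ times; \item the value $(l-1)2^{m}$ occurs $\frac{(2^{2m}-1)((2^m+2)l-2^m-1)}{l^2}$ times; \item the value $-2^{m}$ occurs $2^{3m}-1+\frac{(2^{2m}-1)(2^{m}+1-(2^{m+1}+3)l)}{2l^2}$ times. \end{itemize}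
   Context: $\mathrm{Tr}_m$ and $\mathrm{Tr}_n$ denote the absolute trace maps from $\mathbb{F}_{2^m}$ and from $\mathbb{F}_{2^n}$, respectively, to $\mathbb{F}_2$. The value distribution of $S(a,b)$ is the list of values taken together with the number of pairs $(a,b)\in\mathbb{F}_{2^m}\times\mathbb{F}_{2^n}$ at which each is taken. *)

theory Defs
  imports
    Complex_Main
    "HOL-Library.Cardinality"
    "HOL-Number_Theory.Number_Theory"
    "HOL-Computational_Algebra.Primes"
begin

definition is_subfield :: "'a::field set \<Rightarrow> bool" where
  "is_subfield K \<longleftrightarrow>
     0 \<in> K \<and> 1 \<in> K \<and>
     (\<forall>x\<in>K. \<forall>y\<in>K. x + y \<in> K \<and> x * y \<in> K) \<and>
     (\<forall>x\<in>K. - x \<in> K \<and> inverse x \<in> K)"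

text \<open>
  The absolute trace from the field with \<open>2 ^ k\<close> elements to its prime field, as the sum of the
  conjugates under the Frobenius automorphism. It takes values in the prime field \<open>{0, 1}\<close>
  of the ambient field \<^typ>\<open>'a\<close> when \<open>x\<close> lies in the subfield with \<open>2 ^ k\<close> elements.
\<close>

definition abs_trace :: "nat \<Rightarrow> 'a::field \<Rightarrow> 'a" where
  "abs_trace k x = (\<Sum>i<k. x ^ (2 ^ i))"

text \<open>
  \<open>(-1) ^ t\<close> for an exponent \<open>t\<close> in the field with two elements, represented as the prime field
  \<open>{0, 1}\<close> of \<^typ>\<open>'a\<close>; the value at other elements of \<^typ>\<open>'a\<close> is irrelevant.
\<close>

definition sign_F2 :: "'a::field \<Rightarrow> int" where
  "sign_F2 t = (if t = 0 then 1 else - 1)"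

definition exp_sum :: "nat \<Rightarrow> nat \<Rightarrow> nat \<Rightarrow> 'a::finite_field \<Rightarrow> 'a \<Rightarrow> int" where
  "exp_sum m n d a b =
     (\<Sum>x\<in>UNIV. sign_F2 (abs_trace m (a * x ^ (2 ^ m + 1)) + abs_trace n (b * x ^ d)))"

definition value_count :: "('b \<Rightarrow> 'c \<Rightarrow> 'v) \<Rightarrow> 'b set \<Rightarrow> 'c set \<Rightarrow> 'v \<Rightarrow> nat" where
  "value_count S A B v = card {(a, b). a \<in> A \<and> b \<in> B \<and> S a b = v}"

end

theory Submission
  imports Defs "HOL-Computational_Algebra.Polynomial"
begin

text \<open>
  Write \<open>q = 2 ^ m\<close> and let \<open>U\<close> be the group of \<open>(q + 1)\<close>-th roots of unity. Every nonzero \<open>x\<close> is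
  uniquely \<open>y * u\<close> with \<open>y\<close> in \<open>K - {0}\<close> and \<open>u\<close> in \<open>U\<close>, and \<open>x ^ d = y * u ^ d\<close> since
  \<open>d\<close> is congruent to 1 modulo \<open>q - 1\<close>. As the trace is invariant under squaring, the exponent
  becomes \<open>Tr\<^sub>m ((a + (b * u ^ d + (b * u ^ d) ^ q)\<^sup>2) * y\<^sup>2)\<close>, and summing over \<open>y\<close> gives
  \<open>S a b = (N - 1) * q\<close>, where \<open>N\<close> is the number of \<open>u\<close> in \<open>U\<close> at which the coefficient of \<open>y\<^sup>2\<close>
  vanishes. Since \<open>u \<mapsto> u ^ d\<close> is \<open>l\<close>-to-one on \<open>U\<close>, \<open>N = l * M\<close>, where \<open>M\<close> counts the
  zeros \<open>w = u ^ d\<close> in the image. For \<open>b \<noteq> 0\<close> two distinct zeros have product \<open>b ^ (q - 1)\<close>;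
  hence \<open>M\<close> is at most 2 unless \<open>a = b = 0\<close>, and the first two factorial moments of \<open>M\<close> are
  computable. They determine how often \<open>M\<close> is 0, 1 and 2.
\<close>

section \<open>Roots of unity in finite fields\<close>

lemma card_power_eq_le:
  fixes y :: "'a::idom"
  assumes "0 < i"
  shows "card {x. x ^ i = y} \<le> i"
proof -
  let ?p = "monom 1 i - [:y:]"
  have "coeff ?p i = 1"
    using assms by (simp add: coeff_pCons split: nat.split)
  then have "?p \<noteq> 0"
    by (metis coeff_0 zero_neq_one)
  then have "card {x. poly ?p x = 0} \<le> degree ?p"
    by (rule card_poly_roots_bound)
  also have "degree ?p \<le> i"
    by (intro degree_diff_le degree_monom_le) auto
  finally show ?thesis
    by (simp add: poly_monom)
qed

lemma power_gcd_eq_1: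
  fixes x :: "'a::idom"
  assumes "x ^ a = 1" "x ^ b = 1"
  shows "x ^ gcd a b = 1"
proof (cases "a = 0")
  case False
  then obtain r s where "a * r = b * s + gcd a b"
    using bezout_nat by blast
  then have "x ^ (a * r) = x ^ (b * s) * x ^ gcd a b"
    by (simp add: power_add)
  then show ?thesis
    using assms by (simp add: power_mult)
qed (use assms in simp)

lemma power_card_minus_1:
  fixes x :: "'a::finite_field"
  assumes "x \<noteq> 0"
  shows "x ^ (CARD('a) - 1) = 1"
proof -
  have "x * x ^ (CARD('a) - 1) = x"
    using finite_field_power_card_eq_same[of x] zero_less_card_finite[where ?'a = 'a]
    by (simp flip: power_Suc)
  then show ?thesis
    using assms by simp
qed

text \<open>Double counting replaces a primitive element: \<open>x ^ i\<close> maps the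
  \<open>i * j\<close> units into the \<open>j\<close>-th roots of unity, with fibres of size at
  most \<open>i\<close> over at most \<open>j\<close> points. The total forces equality in both
  bounds.\<close>

lemma
  fixes i j :: nat
  assumes ij: "CARD('a::finite_field) - 1 = i * j"
  shows card_roots_of_unity: "card {x::'a. x ^ j = 1} = j"
    and card_power_eq: "\<And>y::'a. y ^ j = 1 \<Longrightarrow> card {x. x ^ i = y} = i"
proof -
  let ?R = "{y::'a. y ^ j = 1}"
  have "card {0, 1::'a} \<le> CARD('a)"
    by (rule card_mono) auto
  then have pos: "0 < i" "0 < j"
    using ij by (auto intro!: Nat.gr0I)
  have "i * j = card (- {0::'a})"
    using ij by (simp add: Compl_eq_Diff_UNIV card_Diff_singleton_if)
  also have "\<dots> = (\<Sum>y\<in>?R. card {x \<in> - {0}. x ^ i = y})"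
  proof -
    have "(\<lambda>x. x ^ i) ` (- {0}) \<subseteq> ?R"
      using power_card_minus_1[where ?'a = 'a] ij by (auto simp flip: power_mult)
    then show ?thesis
      using sum.group[of "- {0::'a}" ?R "\<lambda>x. x ^ i" "\<lambda>_. 1::nat"] by simp
  qed
  also have "\<dots> = (\<Sum>y\<in>?R. card {x. x ^ i = y})"
    using pos by (intro sum.cong arg_cong[where f = card]) (auto simp: power_0_left)
  finally have eq: "i * j = (\<Sum>y\<in>?R. card {x. x ^ i = y})" .
  have le: "card {x::'a. x ^ i = y} \<le> i" for y
    using card_power_eq_le pos by blast
  have "i * j \<le> i * card ?R"
    unfolding eq using sum_bounded_above[of ?R "\<lambda>y. card {x. x ^ i = y}" i] le
    by (simp add: mult.commute)
  with pos card_power_eq_le[of j "1::'a"] show card_R: "card ?R = j"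
    by simp
  show "card {x. x ^ i = y} = i" if "y ^ j = 1" for y :: 'a
  proof (rule ccontr)
    assume "card {x. x ^ i = y} \<noteq> i"
    then have "(\<Sum>y\<in>?R. card {x. x ^ i = y}) < (\<Sum>y\<in>?R. i)"
      using that le by (intro sum_strict_mono_ex1) (auto intro!: bexI[of _ y] simp: le_less)
    then show False
      using eq card_R by (simp add: mult.commute)
  qed
qed

text \<open>Fermat's argument: multiplication by \<open>x\<close> permutes \<open>K - {0}\<close>,
  so the product over \<open>K - {0}\<close> can be cancelled.\<close>

lemma power_card_subfield:
  fixes x :: "'a::finite_field"
  assumes "is_subfield K" "x \<in> K"
  shows "x ^ card K = x"
proof (cases "x = 0")
  case False
  have K: "0 \<in> K" "\<And>x y. x \<in> K \<Longrightarrow> y \<in> K \<Longrightarrow> x * y \<in> K" "\<And>x. x \<in> K \<Longrightarrow> inverse x \<in> K"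
    using assms(1) by (auto simp: is_subfield_def)
  have "x * (\<Prod>y\<in>K-{0}. x * y) = x * x ^ (card K - 1) * \<Prod>(K-{0})"
    using K(1) by (simp add: prod.distrib mult_ac card_Diff_singleton)
  also have "x * x ^ (card K - 1) = x ^ Suc (card K - 1)"
    by (subst power_Suc) auto
  also have "Suc (card K - 1) = card K"
    using K(1) by (metis Suc_diff_1 card_gt_0_iff empty_iff finite)
  also have "(\<Prod>y\<in>K-{0}. x * y) = (\<Prod>y\<in>K-{0}. y)"
    by (rule prod.reindex_bij_witness[of _ "\<lambda>y. y * inverse x" "\<lambda>y. x * y"])
      (use False assms(2) K in auto)
  finally show ?thesis
    by simp
next
  case True
  then show ?thesis
    using assms by (auto simp: card_gt_0_iff)
qed

section \<open>Quadratic extensions in characteristic two\<close>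

locale quadratic_extension =
  fixes K :: "'a::finite_field set" and m :: nat
  assumes m_pos: "1 \<le> m"
    and card_UNIV: "CARD('a) = 2 ^ (2 * m)"
    and subfield: "is_subfield K"
    and card_K: "card K = 2 ^ m"
begin

definition q :: nat where "q = 2 ^ m"

text \<open>The kernel of the norm map to \<open>K\<close>; on it the conjugation
  \<open>u ^ q\<close> is inversion.\<close>

definition U :: "'a set" where "U = {u. u ^ (q + 1) = 1}"

lemma q_ge_2: "2 \<le> q"
  using power_increasing[OF m_pos, of "2::nat"] by (simp add: q_def)

lemma card_UNIV_q: "CARD('a) = q * q"
  by (simp add: card_UNIV q_def power_mult mult.commute[of 2] power2_eq_square)

lemma card_minus_1: "CARD('a) - 1 = (q - 1) * (q + 1)"
  by (simp add: card_UNIV_q algebra_simps)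

section \<open>Arithmetic in characteristic two and the subfield as a fixed set\<close>

lemma CHAR_2: "CHAR('a) = 2"
proof -
  have "CHAR('a) dvd 2 ^ (2 * m)"
    using CHAR_dvd_CARD[where ?'a = 'a] card_UNIV by simp
  then show ?thesis
    by (metis CHAR_prime prime_dvd_power primes_dvd_imp_eq two_is_prime_nat)
qed

lemma two_eq_0: "(2::'a) = 0"
  using of_nat_CHAR[where ?'a = 'a] by (simp add: CHAR_2)

lemma add_self: "x + x = (0::'a)"
  by (simp add: two_eq_0 flip: mult_2)

lemma minus_eq: "- x = (x::'a)"
  by (metis add_self minus_unique)

lemma add_eq_0_iff': "x + y = 0 \<longleftrightarrow> x = (y::'a)"
  by (metis add_eq_0_iff2 minus_eq)

lemma add_power_2_power: "(x + y :: 'a) ^ 2 ^ k = x ^ 2 ^ k + y ^ 2 ^ k"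
  by (rule freshmans_dream'[of _ k]) (simp_all add: CHAR_2)

lemma add_power2: "(x + y :: 'a)\<^sup>2 = x\<^sup>2 + y\<^sup>2"
  using add_power_2_power[of x y 1] by simp

lemma add_power_q: "(x + y :: 'a) ^ q = x ^ q + y ^ q"
  by (simp add: q_def add_power_2_power)

lemma power_q_q: "(x ^ q) ^ q = (x::'a)"
  using finite_field_power_card_eq_same[of x] by (simp add: card_UNIV_q power_mult)

lemma power2_inj: "x\<^sup>2 = y\<^sup>2 \<Longrightarrow> x = (y::'a)"
  by (metis add_eq_0_iff' add_power2 zero_eq_power2)

lemma power_q_minus_1: "x \<noteq> 0 \<Longrightarrow> x ^ q = x \<longleftrightarrow> x ^ (q - 1) = (1::'a)"
  using q_ge_2 by (cases q) auto

text \<open>\<open>K\<close> lies in the fixed set of \<open>x ^ q\<close>, which has at most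
  \<open>q\<close> elements. Membership in \<open>K\<close> thereby becomes an equation, from which
  the closure properties follow by computation.\<close>

lemma K_eq: "K = {x. x ^ q = x}"
proof (rule card_seteq)
  have "{x. x ^ q = x} \<subseteq> insert 0 {x::'a. x ^ (q - 1) = 1}"
    using power_q_minus_1 by auto
  then have "card {x::'a. x ^ q = x} \<le> card (insert 0 {x::'a. x ^ (q - 1) = 1})"
    by (intro card_mono) auto
  also have "\<dots> \<le> Suc (card {x::'a. x ^ (q - 1) = 1})"
    by (rule card_insert_le_m1) auto
  also have "card {x::'a. x ^ (q - 1) = 1} \<le> q - 1"
    using q_ge_2 by (intro card_power_eq_le) auto
  finally show "card {x::'a. x ^ q = x} \<le> card K"
    using q_ge_2 by (simp add: card_K flip: q_def)
qed (use power_card_subfield[OF subfield] in \<open>auto simp: card_K q_def\<close>)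

lemma K_add: "x \<in> K \<Longrightarrow> y \<in> K \<Longrightarrow> x + y \<in> K"
  by (simp add: K_eq add_power_q)

lemma K_mult: "x \<in> K \<Longrightarrow> y \<in> K \<Longrightarrow> x * y \<in> K"
  by (simp add: K_eq power_mult_distrib)

lemma K_power: "x \<in> K \<Longrightarrow> x ^ i \<in> K"
  by (simp add: K_eq) (metis mult.commute power_mult)

lemma K_0: "0 \<in> K"
  using q_ge_2 by (simp add: K_eq)

lemma K_divide: "x \<in> K \<Longrightarrow> y \<in> K \<Longrightarrow> x / y \<in> K"
  by (simp add: K_eq power_divide)

lemma conj_sum_in_K: "x + x ^ q \<in> K"
  by (simp add: K_eq add_power_q power_q_q add.commute)

section \<open>The norm-one group and polar coordinates\<close>

lemma card_U: "card U = q + 1"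
  unfolding U_def by (rule card_roots_of_unity[OF card_minus_1])

lemma U_nonzero: "u \<in> U \<Longrightarrow> u \<noteq> 0"
  by (auto simp: U_def)

lemma U_power_q: "u \<in> U \<Longrightarrow> u ^ q = inverse u"
  by (simp add: U_def inverse_unique mult.commute)

lemma U_mult: "u \<in> U \<Longrightarrow> v \<in> U \<Longrightarrow> u * v \<in> U"
  by (simp add: U_def power_mult_distrib del: power_Suc)

lemma U_divide: "u \<in> U \<Longrightarrow> v \<in> U \<Longrightarrow> u / v \<in> U"
  by (simp add: U_def power_divide del: power_Suc)

lemma U_power: "u \<in> U \<Longrightarrow> u ^ i \<in> U"
  unfolding U_def mem_Collect_eq by (metis mult.commute power_mult power_one)

lemma card_power_q_minus_1: "w \<in> U \<Longrightarrow> card {b. b ^ (q - 1) = w} = q - 1"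
  by (rule card_power_eq[OF card_minus_1]) (simp add: U_def)

lemma K_inter_U:
  assumes "t \<in> K" "t \<in> U"
  shows "t = 1"
proof -
  have "t * t = 1"
    using assms by (simp add: K_eq U_def)
  then show ?thesis
    using power2_inj[of t 1] by (simp add: power2_eq_square)
qed

text \<open>Injective because \<open>y / y' = u' / u\<close> lies in both \<open>K\<close> and
  \<open>U\<close>, hence equals 1; surjective because both sides have
  \<open>(q - 1) * (q + 1)\<close> elements.\<close>

lemma polar: "bij_betw (\<lambda>(y, u). y * u) ((K - {0}) \<times> U) (- {0})"
proof -
  have "y = y' \<and> u = u'"
    if *: "y \<in> K" "y \<noteq> 0" "u \<in> U" "y' \<in> K" "y' \<noteq> 0" "u' \<in> U" "y * u = y' * u'"
    for y u y' u'
  proof -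
    have "y / y' = u' / u"
      using * by (simp add: frac_eq_eq U_nonzero mult.commute)
    with * have "y / y' = 1"
      using K_inter_U[of "y / y'"] K_divide[of y y'] U_divide[of u' u] by auto
    with * show ?thesis
      by auto
  qed
  then have inj: "inj_on (\<lambda>(y, u). y * u) ((K - {0}) \<times> U)"
    by (auto simp: inj_on_def)
  have "(\<lambda>(y, u). y * u) ` ((K - {0}) \<times> U) = - {0}"
  proof (rule card_subset_eq)
    show "card ((\<lambda>(y, u). y * u) ` ((K - {0}) \<times> U)) = card (- {0::'a})"
      using card_image[OF inj] card_minus_1 K_0
      by (simp add: card_cartesian_product card_U card_K Compl_eq_Diff_UNIV card_Diff_singleton_if q_def)
  qed (auto simp: U_nonzero)
  with inj show ?thesis
    by (simp add: bij_betw_def)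
qed

section \<open>Traces and character sums\<close>

lemma abs_trace_0: "abs_trace k (0::'a) = 0"
  by (simp add: abs_trace_def power_0_left)

lemma abs_trace_add: "abs_trace k (x + y) = abs_trace k x + abs_trace k (y::'a)"
  by (simp add: abs_trace_def add_power_2_power sum.distrib)

lemma abs_trace_add_index: "abs_trace (j + k) x = abs_trace j x + abs_trace k (x ^ 2 ^ j)"
  by (induction k) (simp_all add: abs_trace_def power_add power_mult add.assoc)

text \<open>Transitivity of the trace: \<open>x + x ^ q\<close> is the relative trace to
  \<open>K\<close>.\<close>

lemma abs_trace_double: "abs_trace (2 * m) x = abs_trace m (x + x ^ q)" for x :: 'a
  by (simp add: mult_2 abs_trace_add_index abs_trace_add q_def)

text \<open>Squaring shifts the conjugates cyclically, since \<open>z ^ 2 ^ m = z\<close> on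
  \<open>K\<close>.\<close>

lemma abs_trace_power2:
  assumes "z \<in> K"
  shows "abs_trace m (z\<^sup>2) = abs_trace m z"
proof -
  have "z + abs_trace m (z\<^sup>2) = (\<Sum>i<Suc m. z ^ 2 ^ i)"
    by (subst sum.lessThan_Suc_shift) (simp add: abs_trace_def flip: power_mult)
  also have "\<dots> = abs_trace m z + z"
    using assms by (simp add: abs_trace_def K_eq q_def)
  finally show ?thesis
    by simp
qed

lemma abs_trace_range:
  assumes "z \<in> K"
  shows "abs_trace m z \<in> {0, 1}"
proof -
  have "(abs_trace m z)\<^sup>2 = abs_trace m (z\<^sup>2)"
    unfolding abs_trace_def
    by (subst freshmans_dream_sum) (simp_all add: CHAR_2 mult.commute flip: power_mult)
  then have "(abs_trace m z)\<^sup>2 = abs_trace m z"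
    using abs_trace_power2[OF assms] by simp
  then show ?thesis
    by (simp add: power2_eq_square)
qed

lemma sign_F2_add: "s \<in> {0, 1} \<Longrightarrow> t \<in> {0, 1::'a} \<Longrightarrow> sign_F2 (s + t) = sign_F2 s * sign_F2 t"
  by (auto simp: sign_F2_def two_eq_0)

text \<open>Otherwise all \<open>q\<close> elements of \<open>K\<close> would be roots of the trace
  polynomial, which is nonzero (its linear coefficient is 1) and has degree at most
  \<open>2 ^ (m - 1) < q\<close>.\<close>

lemma abs_trace_nonzero: "\<exists>z\<in>K. abs_trace m z = 1"
proof (rule ccontr)
  assume "\<not> ?thesis"
  then have zero: "K \<subseteq> {z. abs_trace m z = 0}"
    using abs_trace_range by blast
  define p :: "'a poly" where "p = (\<Sum>i<m. monom 1 (2 ^ i))"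
  have "coeff p 1 = (\<Sum>i<m. if i = 0 then 1 else 0)"
    unfolding p_def coeff_sum by (intro sum.cong) auto
  also have "\<dots> = 1"
    using m_pos by simp
  finally have "p \<noteq> 0"
    by auto
  have "q = card K"
    by (simp add: card_K q_def)
  also have "\<dots> \<le> card {z. poly p z = 0}"
    using zero by (intro card_mono) (auto simp: p_def poly_sum poly_monom abs_trace_def)
  also have "\<dots> \<le> degree p"
    by (rule card_poly_roots_bound) fact
  also have "\<dots> \<le> 2 ^ (m - 1)"
    unfolding p_def
    by (intro degree_sum_le) (auto intro!: order.trans[OF degree_monom_le] power_increasing)
  finally show False
    using m_pos unfolding q_def by (cases m) auto
qed

text \<open>Orthogonality of characters: for \<open>c \<noteq> 0\<close> scaling by \<open>c\<close>
  permutes \<open>K\<close>, and translation by an element of trace 1 flips every sign, so the sum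
  equals its own negative.\<close>

lemma sum_sign_trace:
  assumes "c \<in> K"
  shows "(\<Sum>y\<in>K. sign_F2 (abs_trace m (c * y))) = (if c = 0 then int q else 0)"
proof (cases "c = 0")
  case False
  let ?T = "\<Sum>z\<in>K. sign_F2 (abs_trace m z)"
  obtain z0 where z0: "z0 \<in> K" "abs_trace m z0 = 1"
    using abs_trace_nonzero by blast
  have "?T = (\<Sum>z\<in>K. sign_F2 (abs_trace m (z + z0)))"
    by (rule sum.reindex_bij_witness[of _ "\<lambda>z. z + z0" "\<lambda>z. z + z0"])
      (use z0 in \<open>auto simp: K_add add.assoc add_self\<close>)
  also have "\<dots> = (\<Sum>z\<in>K. - sign_F2 (abs_trace m z))"
    using z0 abs_trace_range
    by (intro sum.cong refl) (simp add: abs_trace_add sign_F2_add, simp add: sign_F2_def)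
  finally have "?T = 0"
    by (simp add: sum_negf)
  moreover have "(\<Sum>y\<in>K. sign_F2 (abs_trace m (c * y))) = ?T"
    by (rule sum.reindex_bij_witness[of _ "\<lambda>z. z / c" "\<lambda>y. c * y"])
      (use False assms in \<open>auto simp: K_mult K_divide\<close>)
  ultimately show ?thesis
    using False by simp
qed (simp add: abs_trace_0 sign_F2_def card_K q_def)

text \<open>Squaring permutes \<open>K\<close>, which reduces this to the linear sum; the
  \<open>- 1\<close> removes the term at \<open>y = 0\<close>.\<close>

lemma sum_sign_trace_power2:
  assumes "c \<in> K"
  shows "(\<Sum>y\<in>K - {0}. sign_F2 (abs_trace m (c * y\<^sup>2))) = (if c = 0 then int q else 0) - 1"
proof -
  have inj: "inj_on (\<lambda>y. y\<^sup>2) K"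
    using power2_inj by (auto intro: inj_onI)
  moreover have "(\<lambda>y. y\<^sup>2) ` K = K"
    by (rule endo_inj_surj) (auto simp: K_power inj)
  ultimately have "(\<Sum>y\<in>K. sign_F2 (abs_trace m (c * y\<^sup>2))) = (\<Sum>y\<in>K. sign_F2 (abs_trace m (c * y)))"
    using sum.reindex[OF inj, of "\<lambda>y. sign_F2 (abs_trace m (c * y))"] by simp
  then show ?thesis
    using sum_sign_trace[OF assms] K_0 by (simp add: sum_diff1 abs_trace_0) (simp add: sign_F2_def)
qed

section \<open>Reduction of the exponential sum to a count of zeros\<close>

definition zeros :: "'a set \<Rightarrow> 'a \<Rightarrow> 'a \<Rightarrow> 'a set" where
  "zeros W a b = {w \<in> W. a = (b * w + (b * w) ^ q)\<^sup>2}"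

text \<open>The norm of \<open>y * u\<close> is \<open>y\<^sup>2\<close> and
  \<open>y ^ d = y\<close>. The second trace is thus that of \<open>y\<close> times a relative trace
  in \<open>K\<close>; squaring this argument allows \<open>y\<^sup>2\<close> to be factored out of
  both terms.\<close>

lemma trace_polar:
  assumes "d = s * (q - 1) + 1" "a \<in> K" "y \<in> K" "y \<noteq> 0" "u \<in> U"
  shows "abs_trace m (a * (y * u) ^ (2 ^ m + 1)) + abs_trace (2 * m) (b * (y * u) ^ d)
    = abs_trace m ((a + (b * u ^ d + (b * u ^ d) ^ q)\<^sup>2) * y\<^sup>2)"
proof -
  define t where "t = b * u ^ d"
  have "y ^ q = y"
    using assms by (simp add: K_eq)
  then have "y ^ (q - 1) = 1"
    using power_q_minus_1 assms by blast
  then have "y ^ d = y"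
    by (simp add: assms(1) power_add power_mult mult.commute[of s])
  then have d: "b * (y * u) ^ d = y * t"
    by (simp add: power_mult_distrib t_def)
  have "(y * u) ^ (2 ^ m + 1) = y\<^sup>2"
    using assms(5) \<open>y ^ q = y\<close>
    by (simp add: power_mult_distrib U_def power2_eq_square flip: q_def)
  moreover have "abs_trace (2 * m) (y * t) = abs_trace m (y * (t + t ^ q))"
    by (simp add: abs_trace_double power_mult_distrib \<open>y ^ q = y\<close> distrib_left)
  moreover have "\<dots> = abs_trace m ((y * (t + t ^ q))\<^sup>2)"
    using assms by (intro abs_trace_power2[symmetric] K_mult conj_sum_in_K)
  moreover have "(a + (t + t ^ q)\<^sup>2) * y\<^sup>2 = a * y\<^sup>2 + (y * (t + t ^ q))\<^sup>2"
    by (subst distrib_right) (simp add: power_mult_distrib)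
  ultimately show ?thesis
    unfolding d t_def[symmetric] by (simp only: abs_trace_add)
qed

text \<open>The point 0 contributes 1, and each of the \<open>q + 1\<close> elements of
  \<open>U\<close> contributes \<open>q - 1\<close> at a zero and \<open>- 1\<close>
  elsewhere.\<close>

lemma exp_sum_eq:
  assumes d: "d = s * (q - 1) + 1" and a: "a \<in> K"
  shows "exp_sum m (2 * m) d a b
    = (int (card {u \<in> U. u ^ d \<in> zeros UNIV a b}) - 1) * int q"
proof -
  define f where
    "f x = sign_F2 (abs_trace m (a * x ^ (2 ^ m + 1)) + abs_trace (2 * m) (b * x ^ d))" for x
  define c where "c u = a + (b * u ^ d + (b * u ^ d) ^ q)\<^sup>2" for u
  have c_K: "c u \<in> K" for u
    unfolding c_def using a by (intro K_add K_power conj_sum_in_K)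
  have c_0: "c u = 0 \<longleftrightarrow> u ^ d \<in> zeros UNIV a b" for u
    by (simp add: c_def zeros_def add_eq_0_iff')
  have "exp_sum m (2 * m) d a b = f 0 + sum f (- {0})"
    unfolding exp_sum_def f_def[symmetric]
    by (metis Compl_eq_Diff_UNIV UNIV_I finite sum.remove)
  also have "sum f (- {0}) = (\<Sum>(y, u)\<in>(K - {0}) \<times> U. f (y * u))"
    using sum.reindex_bij_betw[OF polar, of f] by (simp add: case_prod_unfold)
  also have "\<dots> = (\<Sum>u\<in>U. \<Sum>y\<in>K - {0}. sign_F2 (abs_trace m (c u * y\<^sup>2)))"
  proof -
    have "f (y * u) = sign_F2 (abs_trace m (c u * y\<^sup>2))" if "y \<in> K - {0}" "u \<in> U" for y u
      using trace_polar[OF d a _ _ that(2)] that(1) by (simp only: f_def c_def) simp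
    then show ?thesis
      by (subst sum.swap) (simp add: sum.cartesian_product[symmetric])
  qed
  also have "\<dots> = (\<Sum>u\<in>U. (if c u = 0 then int q else 0) - 1)"
    by (intro sum.cong refl sum_sign_trace_power2 c_K)
  also have "\<dots> = int q * card {u \<in> U. c u = 0} - (int q + 1)"
    by (simp add: sum_subtractf card_U sum.If_cases Int_def mult.commute)
  also have "f 0 = 1"
    by (simp add: f_def d abs_trace_0) (simp add: sign_F2_def)
  finally show ?thesis
    by (simp add: c_0 algebra_simps)
qed

section \<open>Moments of the number of zeros\<close>

text \<open>Since \<open>w ^ q = inverse w\<close> on \<open>U\<close>, the difference of the two
  sides is \<open>(w - w') * (b * w * w' - b ^ q)\<close> divided by \<open>w * w'\<close>.\<close>

lemma collision:
  assumes "w \<in> U" "w' \<in> U" "w \<noteq> w'"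
  shows "b * w + (b * w) ^ q = b * w' + (b * w') ^ q \<longleftrightarrow> b = 0 \<or> b ^ (q - 1) = w * w'"
proof -
  have [simp]: "w \<noteq> 0" "w' \<noteq> 0"
    using assms U_nonzero by auto
  have "b * w + (b * w) ^ q = b * w' + (b * w') ^ q
      \<longleftrightarrow> b * w + b ^ q / w = b * w' + b ^ q / w'"
    using assms by (simp add: power_mult_distrib U_power_q field_simps)
  also have "\<dots> \<longleftrightarrow> (w - w') * (b * (w * w') - b ^ q) = 0"
    by (simp add: field_simps)
  also have "\<dots> \<longleftrightarrow> b * (w * w') = b * b ^ (q - 1)"
    using assms q_ge_2 by (cases q) auto
  finally show ?thesis
    by auto
qed

lemma card_collisions:
  assumes "w \<in> U" "w' \<in> U" "w \<noteq> w'"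
  shows "card {b. b * w + (b * w) ^ q = b * w' + (b * w') ^ q} = q"
proof -
  have "{b. b * w + (b * w) ^ q = b * w' + (b * w') ^ q} = insert 0 {b. b ^ (q - 1) = w * w'}"
    using collision[OF assms] by auto
  moreover have "0 \<notin> {b. b ^ (q - 1) = w * w'}"
    using assms q_ge_2 by (auto simp: power_0_left U_nonzero)
  ultimately show ?thesis
    using card_power_q_minus_1[OF U_mult[OF assms(1,2)]] q_ge_2 by simp
qed

text \<open>Three distinct zeros would satisfy \<open>x * y = b ^ (q - 1) = x * z\<close>. Here
  \<open>b \<noteq> 0\<close>, because \<open>b = 0\<close> together with a zero forces
  \<open>a = 0\<close>.\<close>

lemma card_zeros_le_2:
  assumes "W \<subseteq> U" "(a, b) \<noteq> (0, 0)"
  shows "card (zeros W a b) \<le> 2"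
proof (rule ccontr)
  assume "\<not> ?thesis"
  then obtain T where T: "T \<subseteq> zeros W a b" "card T = 3"
    using obtain_subset_with_card_n[of 3 "zeros W a b"] by auto
  then obtain x y z where "T = {x, y, z}" and ne: "x \<noteq> y" "y \<noteq> z" "x \<noteq> z"
    by (auto simp: card_3_iff)
  with T have *: "{x, y, z} \<subseteq> zeros W a b"
    by simp
  then have U: "x \<in> U" "y \<in> U" "z \<in> U"
    using assms by (auto simp: zeros_def)
  from * have "b * x + (b * x) ^ q = b * y + (b * y) ^ q" "b * x + (b * x) ^ q = b * z + (b * z) ^ q"
    by (auto simp: zeros_def intro: power2_inj)
  moreover have "b \<noteq> 0"
    using * assms q_ge_2 by (auto simp: zeros_def)
  ultimately have "x * y = x * z"
    using collision U ne by metis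
  then show False
    using U ne U_nonzero by auto
qed

lemma zeros_0: "zeros W 0 0 = W"
  using q_ge_2 by (auto simp: zeros_def)

lemma card_zeros: "card (zeros W a b) = (\<Sum>w\<in>W. of_bool (a = (b * w + (b * w) ^ q)\<^sup>2))"
  by (simp add: zeros_def of_bool_def sum.If_cases Int_def)

text \<open>First moment: for each \<open>b\<close> and \<open>w\<close> exactly one
  \<open>a\<close> qualifies, as the squared relative trace lies in \<open>K\<close>.\<close>

lemma sum_card_zeros:
  "(\<Sum>a\<in>K. \<Sum>b\<in>UNIV. card (zeros W a b)) = card W * q\<^sup>2"
proof -
  have "(\<Sum>a\<in>K. \<Sum>b\<in>UNIV. card (zeros W a b))
      = (\<Sum>b\<in>UNIV. \<Sum>w\<in>W. \<Sum>a\<in>K. of_bool (a = (b * w + (b * w) ^ q)\<^sup>2))"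
    unfolding card_zeros
    by (rule trans[OF sum.swap sum.cong[OF refl sum.swap]])
  also have "\<dots> = (\<Sum>b\<in>(UNIV :: 'a set). \<Sum>w\<in>W. 1)"
    using K_power[OF conj_sum_in_K] by (intro sum.cong refl) (simp add: of_bool_def)
  finally show ?thesis
    by (simp add: card_UNIV_q power2_eq_square)
qed

text \<open>Second factorial moment: ordered pairs of distinct zeros are counted. For each such
  pair, \<open>a\<close> is determined by \<open>b\<close>, and \<open>card_collisions\<close>
  leaves \<open>q\<close> choices of \<open>b\<close>.\<close>

lemma sum_card_zeros_pairs:
  assumes "W \<subseteq> U"
  shows "(\<Sum>a\<in>K. \<Sum>b\<in>UNIV. card (zeros W a b) * (card (zeros W a b) - 1))
    = card W * (card W - 1) * q"
proof -
  define g where "g b w = (b * w + (b * w) ^ q)\<^sup>2" for b w :: 'a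
  have swap: "(\<Sum>x\<in>X. \<Sum>w\<in>W. \<Sum>w'\<in>W - {w}. h x w w') = (\<Sum>w\<in>W. \<Sum>w'\<in>W - {w}. \<Sum>x\<in>X. h x w w')"
    for X :: "'a set" and h :: "'a \<Rightarrow> 'a \<Rightarrow> 'a \<Rightarrow> nat"
    by (rule trans[OF sum.swap sum.cong[OF refl sum.swap]])
  have g_K: "g b w \<in> K" for b w
    unfolding g_def by (intro K_power conj_sum_in_K)
  have "card (zeros W a b) * (card (zeros W a b) - 1)
      = (\<Sum>w\<in>W. \<Sum>w'\<in>W - {w}. of_bool (a = g b w) * of_bool (a = g b w'))" for a b
  proof -
    have "(\<Sum>w'\<in>W - {w}. of_bool (a = g b w) * of_bool (a = g b w'))
        = of_bool (a = g b w) * (card (zeros W a b) - 1)" if "w \<in> W" for w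
    proof (cases "a = g b w")
      case True
      then have "(\<Sum>w'\<in>W - {w}. of_bool (a = g b w')) = card (zeros W a b) - 1"
        using that by (simp add: card_zeros sum_diff1_nat flip: g_def del: sum_of_bool_eq)
      with True show ?thesis
        by (simp del: sum_of_bool_eq)
    qed simp
    then show ?thesis
      by (simp add: card_zeros g_def flip: sum_distrib_right)
  qed
  then have "(\<Sum>a\<in>K. \<Sum>b\<in>UNIV. card (zeros W a b) * (card (zeros W a b) - 1))
      = (\<Sum>a\<in>K. \<Sum>b\<in>UNIV. \<Sum>w\<in>W. \<Sum>w'\<in>W - {w}. of_bool (a = g b w) * of_bool (a = g b w'))"
    by simp
  also have "\<dots> = (\<Sum>w\<in>W. \<Sum>w'\<in>W - {w}. \<Sum>a\<in>K. \<Sum>b\<in>UNIV. of_bool (a = g b w) * of_bool (a = g b w'))"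
    by (rule trans[OF sum.cong[OF refl swap] swap])
  also have "\<dots> = (\<Sum>w\<in>W. \<Sum>w'\<in>W - {w}. q)"
  proof (intro sum.cong refl)
    fix w w' assume w: "w \<in> W" "w' \<in> W - {w}"
    have "(\<Sum>a\<in>K. of_bool (a = g b w) * of_bool (a = g b w')) = (of_bool (g b w = g b w') :: nat)" for b
      using g_K[of b w] by (auto simp: of_bool_def if_distrib cong: if_cong)
    then have "(\<Sum>a\<in>K. \<Sum>b\<in>UNIV. of_bool (a = g b w) * of_bool (a = g b w'))
        = card {b. g b w = g b w'}"
      by (subst sum.swap) (simp add: of_bool_def sum.If_cases)
    also have "{b. g b w = g b w'} = {b. b * w + (b * w) ^ q = b * w' + (b * w') ^ q}"
      unfolding g_def using power2_inj by auto
    also have "card \<dots> = q"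
      using w assms by (intro card_collisions) auto
    finally show "(\<Sum>a\<in>K. \<Sum>b\<in>UNIV. of_bool (a = g b w) * of_bool (a = g b w')) = q" .
  qed
  also have "\<dots> = card W * (card W - 1) * q"
    by simp
  finally show ?thesis .
qed

section \<open>Fibres of the power map on the norm-one group\<close>

definition power_image :: "nat \<Rightarrow> 'a set" where
  "power_image d = (\<lambda>u. u ^ d) ` U"

lemma power_image_subset: "power_image d \<subseteq> U"
  by (auto simp: power_image_def intro: U_power simp del: power_Suc)

text \<open>The fibre is a coset of the kernel, which consists of all roots of unity of order
  dividing \<open>gcd d (q + 1)\<close>.\<close>

lemma card_power_fibre:
  assumes "w \<in> power_image d"
  shows "card {u \<in> U. u ^ d = w} = gcd d (q + 1)"
proof -
  obtain v where v: "v \<in> U" "w = v ^ d"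
    using assms by (auto simp: power_image_def)
  have "bij_betw (\<lambda>u. u * v) {u \<in> U. u ^ d = 1} {u \<in> U. u ^ d = w}"
    by (rule bij_betw_byWitness[where f' = "\<lambda>u. u / v"])
      (use v in \<open>auto simp: U_nonzero U_mult U_divide power_mult_distrib power_divide\<close>)
  then have "card {u \<in> U. u ^ d = w} = card {u \<in> U. u ^ d = 1}"
    by (simp add: bij_betw_same_card)
  also have "{u \<in> U. u ^ d = 1} = {u. u ^ gcd d (q + 1) = 1}"
  proof (intro equalityI subsetI)
    fix u :: 'a assume *: "u \<in> {u. u ^ gcd d (q + 1) = 1}"
    have "u ^ k = 1" if "gcd d (q + 1) dvd k" for k
      using * that by (auto simp: power_mult elim!: dvdE)
    then show "u \<in> {u \<in> U. u ^ d = 1}"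
      unfolding U_def by blast
  qed (auto simp: U_def intro: power_gcd_eq_1 simp del: power_Suc Suc_eq_plus1)
  also have "card \<dots> = gcd d (q + 1)"
  proof (rule card_roots_of_unity)
    show "CARD('a) - 1 = ((q - 1) * (q + 1) div gcd d (q + 1)) * gcd d (q + 1)"
      unfolding card_minus_1 by (intro dvd_div_mult_self[symmetric] dvd_mult gcd_dvd2)
  qed
  finally show ?thesis .
qed

lemma card_power_vimage:
  assumes "Z \<subseteq> power_image d"
  shows "card {u \<in> U. u ^ d \<in> Z} = gcd d (q + 1) * card Z"
proof -
  have "card {u \<in> U. u ^ d \<in> Z} = (\<Sum>z\<in>Z. card {u \<in> {u \<in> U. u ^ d \<in> Z}. u ^ d = z})"
    using sum.group[of "{u \<in> U. u ^ d \<in> Z}" Z "\<lambda>u. u ^ d" "\<lambda>_. 1::nat"]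
    by (simp add: image_subset_iff)
  also have "\<dots> = (\<Sum>z\<in>Z. card {u \<in> U. u ^ d = z})"
    by (intro sum.cong refl arg_cong[where f = card]) auto
  also have "\<dots> = (\<Sum>z\<in>Z. gcd d (q + 1))"
    using assms by (intro sum.cong refl card_power_fibre) auto
  finally show ?thesis
    by (simp add: mult.commute)
qed

lemma card_power_image: "gcd d (q + 1) * card (power_image d) = q + 1"
proof -
  have "{u \<in> U. u ^ d \<in> power_image d} = U"
    by (auto simp: power_image_def)
  then show ?thesis
    using card_power_vimage[of "power_image d" d] card_U by simp
qed

lemma exp_sum_eq_card_zeros:
  assumes "d = s * (q - 1) + 1" "a \<in> K"
  shows "exp_sum m (2 * m) d a b
    = (int (gcd d (q + 1)) * int (card (zeros (power_image d) a b)) - 1) * int q"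
proof -
  have "{u \<in> U. u ^ d \<in> zeros UNIV a b} = {u \<in> U. u ^ d \<in> zeros (power_image d) a b}"
    by (auto simp: zeros_def power_image_def)
  moreover have "zeros (power_image d) a b \<subseteq> power_image d"
    by (auto simp: zeros_def)
  ultimately show ?thesis
    using exp_sum_eq[OF assms] card_power_vimage[of "zeros (power_image d) a b" d] by simp
qed

text \<open>The pair \<open>(0, 0)\<close> is left out because every point of \<open>W\<close> is a
  zero there, so the bound 2 need not hold.\<close>

definition level :: "'a set \<Rightarrow> nat \<Rightarrow> ('a \<times> 'a) set" where
  "level W i = {(a, b) \<in> K \<times> UNIV - {(0, 0)}. card (zeros W a b) = i}"

text \<open>The shape of the last formula makes it visible that no level is empty.\<close>

lemma
  assumes "W \<subseteq> U"
  shows card_level_2: "2 * int (card (level W 2)) = int (card W) * (int (card W) - 1) * (int q - 1)"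
    and card_level_1: "int (card (level W 1))
      = int (card W) * (int q - 1) * (int q + 2 - int (card W))"
    and card_level_0: "2 * int (card (level W 0)) = (int q - 1)
      * ((int q + 1 - int (card W))\<^sup>2 + (int q + 1 - int (card W)) + int q * (int q - 1))"
proof -
  define E where "E = K \<times> (UNIV :: 'a set) - {(0, 0)}"
  define M where "M = (\<lambda>(a, b). card (zeros W a b))"
  have M_le: "M e \<le> 2" if "e \<in> E" for e
    using that card_zeros_le_2[OF assms] by (auto simp: E_def M_def)
  have M_cases: "M e = 0 \<or> M e = 1 \<or> M e = 2" if "e \<in> E" for e
    using M_le[OF that] by linarith
  have level: "level W i = {e \<in> E. M e = i}" for i
    by (auto simp: level_def E_def M_def)
  have split: "(\<Sum>a\<in>K. \<Sum>b\<in>UNIV. f (card (zeros W a b))) = f (card W) + (\<Sum>e\<in>E. f (M e))" for f :: "nat \<Rightarrow> nat"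
  proof -
    have "(\<Sum>a\<in>K. \<Sum>b\<in>UNIV. f (card (zeros W a b))) = (\<Sum>e\<in>K \<times> UNIV. f (M e))"
      by (simp add: sum.cartesian_product M_def case_prod_unfold)
    also have "\<dots> = f (M (0, 0)) + (\<Sum>e\<in>E. f (M e))"
      unfolding E_def by (rule sum.remove) (use K_0 in auto)
    finally show ?thesis
      by (simp add: M_def zeros_0)
  qed
  have lin: "(\<Sum>e\<in>E. f (M e))
      = f 0 * card (level W 0) + f 1 * card (level W 1) + f 2 * card (level W 2)" for f :: "nat \<Rightarrow> nat"
  proof -
    have "(\<Sum>e\<in>E. f (M e))
        = (\<Sum>e\<in>E. f 0 * of_bool (M e = 0) + f 1 * of_bool (M e = 1) + f 2 * of_bool (M e = 2))"
      using M_cases by (intro sum.cong refl) fastforce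
    also have "\<dots> = f 0 * card (level W 0) + f 1 * card (level W 1) + f 2 * card (level W 2)"
      by (simp add: sum.distrib level Int_def flip: sum_distrib_left)
    finally show ?thesis .
  qed
  let ?H = "int (card W)" and ?Q = "int q"
  \<comment> \<open>Truncated subtraction is harmless: at \<open>card W = 0\<close> the other factor
    vanishes.\<close>
  have H: "int (card W * (card W - 1)) = ?H * (?H - 1)"
    by (cases "card W") (simp_all add: algebra_simps)
  \<comment> \<open>The total count and the first two factorial moments, with \<open>(0, 0)\<close>
    split off, form a triangular linear system for the three level sizes.\<close>
  have *: "1 + (card (level W 0) + card (level W 1) + card (level W 2)) = q * q\<^sup>2"
    using split[of "\<lambda>_. 1"] lin[of "\<lambda>_. 1"]
    by (simp add: card_K card_UNIV_q power2_eq_square flip: q_def)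
  have **: "card W + (card (level W 1) + 2 * card (level W 2)) = card W * q\<^sup>2"
    using split[of "\<lambda>i. i"] lin[of "\<lambda>i. i"] sum_card_zeros by simp
  have ***: "card W * (card W - 1) + 2 * card (level W 2) = card W * (card W - 1) * q"
    using split[of "\<lambda>i. i * (i - 1)"] lin[of "\<lambda>i. i * (i - 1)"] sum_card_zeros_pairs[OF assms]
    by simp
  have l0: "1 + (int (card (level W 0)) + card (level W 1) + card (level W 2)) = ?Q * ?Q\<^sup>2"
    using * by (simp flip: of_nat_mult of_nat_add of_nat_power of_nat_Suc)
  have l1: "?H + (int (card (level W 1)) + 2 * card (level W 2)) = ?H * ?Q\<^sup>2"
    using ** by (simp flip: of_nat_mult of_nat_add of_nat_power)
  have "int (card W * (card W - 1)) + 2 * int (card (level W 2)) = int (card W * (card W - 1)) * ?Q"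
    using arg_cong[OF ***, of int] by simp
  then have l2: "?H * (?H - 1) + 2 * int (card (level W 2)) = ?H * (?H - 1) * ?Q"
    unfolding H .
  then show L2: "2 * int (card (level W 2)) = ?H * (?H - 1) * (?Q - 1)"
    by (simp add: algebra_simps)
  from l1 l2 show L1: "int (card (level W 1)) = ?H * (?Q - 1) * (?Q + 2 - ?H)"
    by (simp add: algebra_simps power2_eq_square)
  have "2 * int (card (level W 0)) = 2 * (?Q * ?Q\<^sup>2 - 1) - 2 * int (card (level W 1)) - 2 * int (card (level W 2))"
    using l0 by simp
  then show "2 * int (card (level W 0))
      = (?Q - 1) * ((?Q + 1 - ?H)\<^sup>2 + (?Q + 1 - ?H) + ?Q * (?Q - 1))"
    unfolding L1 L2 by (simp add: algebra_simps power2_eq_square)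
qed

end

section \<open>The value distribution\<close>

theorem theorem5:
  fixes K :: "'a::finite_field set"
    and m n d\<^sub>2 :: nat
    and s\<^sub>2 l :: int
  assumes "m \<ge> 1"
    and "n = 2 * m"
    and "CARD('a) = 2 ^ n"
    and "is_subfield K"
    and "card K = 2 ^ m"
    and "d\<^sub>2 > 0"
    and "int d\<^sub>2 = s\<^sub>2 * (2 ^ m - 1) + 1"
    and "\<not> [s\<^sub>2 = modular_inverse (2 ^ m + 1) 2] (mod (2 ^ m + 1))"
    and "l = gcd (2 * s\<^sub>2 - 1) (2 ^ m + 1)"
  shows "(\<lambda>(a, b). exp_sum m n d\<^sub>2 a b) ` (K \<times> (UNIV :: 'a set))
           = {2 ^ (2 * m), (2 * l - 1) * 2 ^ m, (l - 1) * 2 ^ m, - (2 ^ m)}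
    \<and> value_count (exp_sum m n d\<^sub>2) K (UNIV :: 'a set) (2 ^ (2 * m)) = 1
    \<and> real (value_count (exp_sum m n d\<^sub>2) K (UNIV :: 'a set) ((2 * l - 1) * 2 ^ m))
        = (2 ^ (2 * m) - 1) * (2 ^ m - real_of_int l + 1) / (2 * (real_of_int l)\<^sup>2)
    \<and> real (value_count (exp_sum m n d\<^sub>2) K (UNIV :: 'a set) ((l - 1) * 2 ^ m))
        = (2 ^ (2 * m) - 1) * ((2 ^ m + 2) * real_of_int l - 2 ^ m - 1) / (real_of_int l)\<^sup>2
    \<and> real (value_count (exp_sum m n d\<^sub>2) K (UNIV :: 'a set) (- (2 ^ m)))
        = 2 ^ (3 * m) - 1
          + (2 ^ (2 * m) - 1) * (2 ^ m + 1 - (2 ^ (m + 1) + 3) * real_of_int l)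
              / (2 * (real_of_int l)\<^sup>2)"
proof -
  interpret quadratic_extension K m
    by unfold_locales (use assms in simp_all)
  define g where "g = gcd d\<^sub>2 (q + 1)"
  define W where "W = power_image d\<^sub>2"
  define S :: "'a \<Rightarrow> 'a \<Rightarrow> int" where "S = exp_sum m n d\<^sub>2"
  have q: "2 ^ m = int q"
    by (simp add: q_def)
  \<comment> \<open>A negative \<open>s\<^sub>2\<close> would give
    \<open>d\<^sub>2 \<le> 2 - q \<le> 0\<close>. Nonnegativity lets the exponent be written over
    the naturals.\<close>
  have "0 \<le> s\<^sub>2"
  proof (rule ccontr)
    assume "\<not> 0 \<le> s\<^sub>2"
    then have "s\<^sub>2 * (int q - 1) \<le> - 1 * (int q - 1)"
      using q_ge_2 by (intro mult_right_mono) auto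
    then show False
      using assms(6,7) q_ge_2 unfolding q by (simp add: algebra_simps)
  qed
  then have "int d\<^sub>2 = int (nat s\<^sub>2 * (q - 1) + 1)"
    using assms(7) q_ge_2 unfolding q by (simp add: of_nat_diff)
  then have d: "d\<^sub>2 = nat s\<^sub>2 * (q - 1) + 1"
    using of_nat_eq_iff by blast
  have l_eq: "l = int g"
  proof -
    \<comment> \<open>Modulo \<open>q + 1\<close> the exponent is the negative of
      \<open>2 * s\<^sub>2 - 1\<close>, so the two gcds agree.\<close>
    have "int d\<^sub>2 = - (2 * s\<^sub>2 - 1) + s\<^sub>2 * (int q + 1)"
      using assms(7) unfolding q by (simp add: algebra_simps)
    then have "int g = gcd (- (2 * s\<^sub>2 - 1) + s\<^sub>2 * (int q + 1)) (int q + 1)"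
      by (metis g_def gcd_int_int_eq of_nat_1 of_nat_add)
    also have "\<dots> = gcd (- (2 * s\<^sub>2 - 1)) (int q + 1)"
      by (simp only: gcd_add_mult add.commute gcd.commute)
    finally show ?thesis
      unfolding assms(9) q by (simp only: gcd_neg1_int)
  qed
  have even_q: "even q"
    using assms(1) by (simp add: q_def)
  \<comment> \<open>Equality would make \<open>s\<^sub>2\<close> an inverse of 2 modulo
    \<open>q + 1\<close>.\<close>
  have g_ne: "g \<noteq> q + 1"
  proof
    assume "g = q + 1"
    then have "int q + 1 dvd 2 * s\<^sub>2 - 1"
      using l_eq assms(9) unfolding q by (metis gcd_dvd1 of_nat_1 of_nat_add)
    then have "[2 * s\<^sub>2 = 1] (mod (int q + 1))"
      by (simp add: cong_iff_dvd_diff)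
    moreover have cop: "coprime 2 (int q + 1)"
      using even_q by simp
    ultimately have "[2 * s\<^sub>2 = 2 * modular_inverse (int q + 1) 2] (mod (int q + 1))"
      using cong_modular_inverse1[OF cop] by (metis cong_sym cong_trans)
    then show False
      using assms(8) cop unfolding q by (simp add: cong_mult_lcancel)
  qed
  have gH: "g * card W = q + 1"
    unfolding g_def W_def by (rule card_power_image)
  have g_pos: "0 < g"
    by (simp add: g_def)
  have g_ne': "2 * g \<noteq> q + 1"
    using even_q by presburger
  have H_le: "card W \<le> q + 1"
    using gH g_pos by (metis dvd_imp_le dvd_triv_right zero_less_Suc Suc_eq_plus1)
  have H_ge: "2 \<le> card W"
    using gH g_ne by (cases "card W" rule: nat.exhaust; cases "card W - 1") auto
  have S: "S a b = (int g * int (card (zeros W a b)) - 1) * int q" if "a \<in> K" for a b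
    unfolding S_def assms(2) g_def W_def using d that by (rule exp_sum_eq_card_zeros)
  have S_eq_iff: "S a b = (int g * k - 1) * int q \<longleftrightarrow> int (card (zeros W a b)) = k"
    if "a \<in> K" for a b k
    unfolding S[OF that] using g_pos q_ge_2 by simp
  \<comment> \<open>This is the value belonging to \<open>card W\<close> zeros, the number at
    \<open>(0, 0)\<close>.\<close>
  have q2: "(2::int) ^ (2 * m) = (int g * int (card W) - 1) * int q"
    using arg_cong[OF gH, of int] by (simp add: power_mult mult.commute[of 2] power2_eq_square q_def)
  \<comment> \<open>The case \<open>card W = 2\<close> fails because \<open>q + 1\<close> is odd.
    With at least three zeros, \<open>(0, 0)\<close> has a value different from those of the levels
    0, 1 and 2.\<close>
  have W_ge_3: "3 \<le> card W"
    using H_ge gH g_ne' by (cases "card W = 2") auto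
  have count: "value_count S K UNIV ((int g * int i - 1) * int q) = card (level W i)" if "i \<le> 2" for i
    unfolding value_count_def level_def
    by (rule arg_cong[where f = card])
      (use W_ge_3 that S_eq_iff K_0 in \<open>auto simp: zeros_0\<close>)
  have count0: "value_count S K UNIV ((int g * int (card W) - 1) * int q) = 1"
  proof -
    have "card (zeros W a b) = card W \<longleftrightarrow> a = 0 \<and> b = 0" for a b
      using card_zeros_le_2[of W a b] W_ge_3 power_image_subset by (fastforce simp: W_def zeros_0)
    then have "{(a, b). a \<in> K \<and> b \<in> UNIV \<and> S a b = (int g * int (card W) - 1) * int q} = {(0, 0)}"
      using S_eq_iff K_0 by auto
    then show ?thesis
      by (simp add: value_count_def)
  qed
  note WU = power_image_subset[of d\<^sub>2, folded W_def]
  define H Q L where "H = real (card W)" and "Q = real q" and "L = real g"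
  have LH: "L * H = Q + 1"
    unfolding L_def H_def Q_def using gH by (metis of_nat_1 of_nat_add of_nat_mult)
  have L: "L > 0" and H: "H = (Q + 1) / L"
    using g_pos LH by (simp_all add: L_def field_simps)
  have card_2: "2 * real (card (level W 2)) = H * (H - 1) * (Q - 1)"
    using arg_cong[OF card_level_2[OF WU], of real_of_int] by (simp add: H_def Q_def)
  have card_1: "real (card (level W 1)) = H * (Q - 1) * (Q + 2 - H)"
    using arg_cong[OF card_level_1[OF WU], of real_of_int] by (simp add: H_def Q_def)
  have card_0: "2 * real (card (level W 0)) = (Q - 1) * ((Q + 1 - H)\<^sup>2 + (Q + 1 - H) + Q * (Q - 1))"
    using arg_cong[OF card_level_0[OF WU], of real_of_int] by (simp add: H_def Q_def)
  have bounds: "3 \<le> H" "H \<le> Q + 1" "2 \<le> Q"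
    using W_ge_3 H_le q_ge_2 by (auto simp: H_def Q_def)
  \<comment> \<open>Nonempty levels are what makes all listed values occur; the three size formulas
    are strictly positive by \<open>bounds\<close>.\<close>
  have ne: "level W i \<noteq> {}" if "i \<le> 2" for i
  proof -
    have "0 < H * (H - 1) * (Q - 1)" "0 < H * (Q - 1) * (Q + 2 - H)"
      "0 < (Q - 1) * ((Q + 1 - H)\<^sup>2 + (Q + 1 - H) + Q * (Q - 1))"
      using bounds by (auto intro!: mult_pos_pos add_nonneg_pos)
    then have "level W 0 \<noteq> {} \<and> level W 1 \<noteq> {} \<and> level W 2 \<noteq> {}"
      unfolding card_0[symmetric] card_1[symmetric] card_2[symmetric] by (simp add: card_gt_0_iff)
    moreover have "i = 0 \<or> i = 1 \<or> i = 2"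
      using that by linarith
    ultimately show ?thesis
      by auto
  qed
  have vals: "(2 * l - 1) * 2 ^ m = (int g * int 2 - 1) * int q"
    "(l - 1) * 2 ^ m = (int g * int 1 - 1) * int q"
    "- (2 ^ m) = (int g * int 0 - 1) * int q"
    by (simp_all add: l_eq q_def)
  have "(\<lambda>(a, b). S a b) ` (K \<times> UNIV)
    = (\<lambda>i. (int g * int i - 1) * int q) ` {card W, 2, 1, 0}" (is "?A = ?f ` _")
  proof (intro equalityI subsetI)
    fix v assume "v \<in> ?A"
    then obtain a b where ab: "a \<in> K" "v = S a b"
      by auto
    have "card (zeros W a b) \<in> {card W, 2, 1, 0}"
    proof (cases "(a, b) = (0, 0)")
      case False
      then have "card (zeros W a b) \<le> 2"
        by (rule card_zeros_le_2[OF WU])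
      then show ?thesis
        by (simp only: insert_iff) linarith
    qed (auto simp: zeros_0)
    then show "v \<in> ?f ` {card W, 2, 1, 0}"
      unfolding ab S[OF ab(1)] by (rule imageI)
  next
    have S_in: "S a b \<in> ?A" if "a \<in> K" for a b
      using that by (intro image_eqI[of _ _ "(a, b)"]) auto
    have "?f i \<in> ?A" if "i \<le> 2" for i
    proof -
      obtain a b where "a \<in> K" "card (zeros W a b) = i"
        using ne[OF \<open>i \<le> 2\<close>] by (auto simp: level_def)
      then show ?thesis
        using S[of a b] S_in[of a b] by metis
    qed
    moreover have "?f (card W) \<in> ?A"
      using S[OF K_0, of 0] S_in[OF K_0, of 0] unfolding zeros_0 by metis
    moreover fix v assume "v \<in> ?f ` {card W, 2, 1, 0}"
    then obtain i where "v = ?f i" "i = card W \<or> i \<le> 2"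
      by fastforce
    ultimately show "v \<in> ?A"
      by blast
  qed
  then have "(\<lambda>(a, b). S a b) ` (K \<times> UNIV)
      = {2 ^ (2 * m), (2 * l - 1) * 2 ^ m, (l - 1) * 2 ^ m, - (2 ^ m)}"
    unfolding q2 vals by simp
  moreover have "value_count S K UNIV (2 ^ (2 * m)) = 1"
    unfolding q2 by (rule count0)
  moreover have "real (value_count S K UNIV ((2 * l - 1) * 2 ^ m))
      = (2 ^ (2 * m) - 1) * (2 ^ m - real_of_int l + 1) / (2 * (real_of_int l)\<^sup>2)"
    and "real (value_count S K UNIV ((l - 1) * 2 ^ m))
      = (2 ^ (2 * m) - 1) * ((2 ^ m + 2) * real_of_int l - 2 ^ m - 1) / (real_of_int l)\<^sup>2"
    and "real (value_count S K UNIV (- (2 ^ m)))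
      = 2 ^ (3 * m) - 1
        + (2 ^ (2 * m) - 1) * (2 ^ m + 1 - (2 ^ (m + 1) + 3) * real_of_int l)
            / (2 * (real_of_int l)\<^sup>2)"
  proof -
    have powers: "(2::real) ^ m = Q" "(2::real) ^ (2 * m) = Q\<^sup>2" "(2::real) ^ (3 * m) = Q ^ 3"
      "(2::real) ^ (m + 1) = 2 * Q" "real_of_int l = L"
      by (simp_all add: Q_def q_def L_def l_eq mult.commute flip: power_mult)
    show "real (value_count S K UNIV ((2 * l - 1) * 2 ^ m))
      = (2 ^ (2 * m) - 1) * (2 ^ m - real_of_int l + 1) / (2 * (real_of_int l)\<^sup>2)"
      unfolding vals powers count[of 2, OF order.refl] using card_2 L
      by (simp add: H field_simps power2_eq_square)
    show "real (value_count S K UNIV ((l - 1) * 2 ^ m))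
      = (2 ^ (2 * m) - 1) * ((2 ^ m + 2) * real_of_int l - 2 ^ m - 1) / (real_of_int l)\<^sup>2"
      unfolding vals powers count[of 1, OF one_le_numeral] using card_1 L
      by (simp add: H field_simps power2_eq_square)
    \<comment> \<open>The visibly positive form is expanded again to isolate the term
      \<open>Q ^ 3 - 1\<close> of the claimed count.\<close>
    have "2 * real (card (level W 0)) = 2 * (Q ^ 3 - 1) - H * ((Q - 1) * (2 * Q + 3 - H))"
      using card_0 by (simp add: algebra_simps power2_eq_square power3_eq_cube)
    then show "real (value_count S K UNIV (- (2 ^ m)))
      = 2 ^ (3 * m) - 1
        + (2 ^ (2 * m) - 1) * (2 ^ m + 1 - (2 ^ (m + 1) + 3) * real_of_int l)
            / (2 * (real_of_int l)\<^sup>2)"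
      unfolding vals powers count[of 0, OF le0] using L
      by (simp add: H field_simps power2_eq_square power3_eq_cube)
  qed
  ultimately show ?thesis
    unfolding S_def by blast
qed

end
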